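(* Let $A$ be a finite set of integers with smallest element $0$ and largest element $b\ge 1$, such that the gcd of the elements of $A$ is $1$. Let $N\ge 1$ be an integer with $N\geq 2\lfloor b/2\rfloor$. If $0 \leq n\leq Nb$ is an integer with $n\notin \mathcal E(A)\cup (Nb- \mathcal E(b-A))$, then $n\in NA$. Equivalently, $$NA = \{0 , 1,\ldots , bN\} \setminus \big(\mathcal E(A) \cup (bN - \mathcal E(b-A))\big).$$
   Context: $\mathbb N=\{0,1,2,\dots\}$. For an integer $N\ge1$, $NA=\{a_1+\cdots+a_N: a_1,\dots,a_N\in A\}$ (the $a_i$ not necessarily distinct). $\mathcal P(A)=\{\sum_{a\in A} n_a a: n_a\in\mathbb N\}$ and the exceptional set is $\mathcal E(A)=\mathbb N\setminus\mathcal P(A)$. $b-A=\{b-a:a\in A\}$, and $\mathcal E(b-A)$ is defined in the same way for the set $b-A$. For an integer $m$ and a set $X$, $m-X=\{m-x:x\in X\}$. *)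

theory Defs
  imports Complex_Main
begin

definition sumset :: "nat \<Rightarrow> int set \<Rightarrow> int set" where
  "sumset N A = {(\<Sum>i<N. f i) | f. \<forall>i<N. f i \<in> A}"

(* Meant for finite A: over an infinite index set the library's sum is 0. *)
definition nat_span :: "int set \<Rightarrow> int set" where
  "nat_span A = {(\<Sum>a\<in>A. int (c a) * a) | c :: int \<Rightarrow> nat. True}"

(* The set difference is taken inside the integers, with the naturals (0 included) as {0..}. *)
definition exceptional :: "int set \<Rightarrow> int set" where
  "exceptional A = {0..} - nat_span A"

definition reflect :: "int \<Rightarrow> int set \<Rightarrow> int set" where
  "reflect m X = (\<lambda>x. m - x) ` X"

end

theory Submission
  imports Defs "HOL-Library.Multiset" "HOL-Number_Theory.Cong"
begin

text \<open>Write n = sum S + i b and N b - n = sum T' + j b, where S over A and T' over b - A consist of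
  elements other than 0 and b and have least sum in their class modulo b and, among those, least
  size; exchanging A and b - A we may assume that T' is not larger than S. We are done if
  size S + i or size T' + j is at most N. Otherwise S has more than b/2 elements, and then S
  can be taken to consist of k copies of a single g. Such a g is a unit modulo b, and every other
  element of A that T' uses is congruent to - w g with w at most b - 1 - k. Exchanging only a few
  elements of T' for copies of g then gives a third representation of n, with at most N summands.\<close>

section \<open>Minimal representations of residue classes modulo b\<close>

text \<open>The order is lexicographic. Least sum keeps the coefficient of b nonnegative when a
  representation is replaced by a minimal one. Least size settles exchanges that leave the sum
  unchanged.\<close>

definition minimal_rep :: "int \<Rightarrow> int set \<Rightarrow> int multiset \<Rightarrow> bool" where
  "minimal_rep b B S \<longleftrightarrow> set_mset S \<subseteq> B \<and>
     (\<forall>V. set_mset V \<subseteq> B \<longrightarrow> [sum_mset V = sum_mset S] (mod b) \<longrightarrow>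
        sum_mset S < sum_mset V \<or> sum_mset S = sum_mset V \<and> size S \<le> size V)"

lemma minimal_repD:
  assumes "minimal_rep b B S" "set_mset V \<subseteq> B" "[sum_mset V = sum_mset S] (mod b)"
  shows "sum_mset S \<le> sum_mset V" and "sum_mset V = sum_mset S \<Longrightarrow> size S \<le> size V"
  using assms unfolding minimal_rep_def by (metis order_less_imp_le order_refl, metis less_irrefl)

lemma sum_mset_pos_bounds:
  fixes M :: "int multiset"
  assumes "set_mset M \<subseteq> {0<..<b}"
  shows "0 \<le> sum_mset M" and "sum_mset M \<le> int (size M) * (b - 1)"
    and "M \<noteq> {#} \<Longrightarrow> 0 < sum_mset M"
proof -
  have "int (size M) \<le> sum_mset M \<and> sum_mset M \<le> int (size M) * (b - 1)"
    using assms by (induction M) (auto simp: algebra_simps)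
  then show "0 \<le> sum_mset M" "sum_mset M \<le> int (size M) * (b - 1)"
    "M \<noteq> {#} \<Longrightarrow> 0 < sum_mset M"
    by (auto simp: nonempty_has_size intro: order_less_le_trans)
qed

lemma minimal_rep_exists:
  assumes B: "B \<subseteq> {0<..<b}" and M: "set_mset M \<subseteq> B"
  obtains S where "minimal_rep b B S" "[sum_mset S = sum_mset M] (mod b)"
    "sum_mset S \<le> sum_mset M"
proof -
  define P where "P V \<longleftrightarrow> set_mset V \<subseteq> B \<and> [sum_mset V = sum_mset M] (mod b)" for V
  \<comment> \<open>Sums over B are nonnegative, so passing to \<open>nat\<close> loses nothing. The
    sum is minimized first, then the size among the minimizers of the sum.\<close>
  obtain S1 where S1: "P S1" "\<And>V. P V \<Longrightarrow> nat (sum_mset S1) \<le> nat (sum_mset V)"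
    using ex_has_least_nat[of P M "\<lambda>V. nat (sum_mset V)"] M by (auto simp: P_def)
  define Q where "Q V \<longleftrightarrow> P V \<and> sum_mset V = sum_mset S1" for V
  obtain S where S: "Q S" "\<And>V. Q V \<Longrightarrow> size S \<le> size V"
    using ex_has_least_nat[of Q S1 size] S1 by (auto simp: Q_def)
  have nonneg: "0 \<le> sum_mset V" if "P V" for V
    using sum_mset_pos_bounds(1)[of V b] that B by (auto simp: P_def)
  have le: "sum_mset S \<le> sum_mset V" if "P V" for V
    using S1(2)[OF that] nonneg[OF that] S(1) by (auto simp: Q_def)
  have "minimal_rep b B S"
    unfolding minimal_rep_def
  proof (intro conjI allI impI)
    show "set_mset S \<subseteq> B" using S(1) by (simp add: Q_def P_def)
  next
    fix V assume V: "set_mset V \<subseteq> B" "[sum_mset V = sum_mset S] (mod b)"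
    then have "P V" using S(1) by (auto simp: Q_def P_def intro: cong_trans)
    then show "sum_mset S < sum_mset V \<or> sum_mset S = sum_mset V \<and> size S \<le> size V"
      using le[of V] S by (auto simp: Q_def)
  qed
  moreover have "P M" using M by (simp add: P_def)
  ultimately show thesis using that le[of M] S(1) by (auto simp: Q_def P_def)
qed

text \<open>A better replacement for U, completed by the rest of S, would be a better replacement
  for S.\<close>

lemma minimal_rep_subset:
  assumes "minimal_rep b B S" "U \<subseteq># S"
  shows "minimal_rep b B U"
  unfolding minimal_rep_def
proof (intro conjI allI impI)
  show "set_mset U \<subseteq> B"
    using assms(1) set_mset_mono[OF assms(2)] by (auto simp: minimal_rep_def)
next
  fix V assume V: "set_mset V \<subseteq> B" "[sum_mset V = sum_mset U] (mod b)"
  obtain X where X: "S = U + X" using assms(2) by (auto simp: mset_subset_eq_exists_conv)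
  have VX: "set_mset (V + X) \<subseteq> B" "[sum_mset (V + X) = sum_mset S] (mod b)"
    using V assms(1) by (auto simp: X minimal_rep_def cong_add)
  show "sum_mset U < sum_mset V \<or> sum_mset U = sum_mset V \<and> size U \<le> size V"
    using minimal_repD[OF assms(1) VX] by (auto simp: X)
qed

text \<open>Such a U competes with the empty multiset, whose sum 0 is smaller than that of any
  nonempty multiset of positive elements.\<close>

lemma minimal_rep_zero_sum_free:
  assumes "B \<subseteq> {0<..<b}" "minimal_rep b B S" "U \<subseteq># S" "b dvd sum_mset U"
  shows "U = {#}"
proof (rule ccontr)
  assume "U \<noteq> {#}"
  have U: "minimal_rep b B U" using minimal_rep_subset assms by blast
  then have "sum_mset U \<le> 0"
    using minimal_repD(1)[OF U, of "{#}"] assms(4) by (simp add: cong_iff_dvd_diff)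
  then show False
    using sum_mset_pos_bounds(3)[of U b] U assms(1) \<open>U \<noteq> {#}\<close> by (auto simp: minimal_rep_def)
qed

lemma minimal_rep_swap:
  assumes S: "minimal_rep b B S" and "U \<subseteq># S" and V: "set_mset V \<subseteq> B"
    and eq: "sum_mset V = sum_mset U" "size V = size U"
  shows "minimal_rep b B (S - U + V)" "sum_mset (S - U + V) = sum_mset S"
    "size (S - U + V) = size S"
proof -
  obtain X where X: "S = U + X" using assms(2) by (auto simp: mset_subset_eq_exists_conv)
  show sum: "sum_mset (S - U + V) = sum_mset S" and size: "size (S - U + V) = size S"
    using eq by (simp_all add: X)
  show "minimal_rep b B (S - U + V)"
    unfolding minimal_rep_def sum size
    using S V by (auto simp: minimal_rep_def dest: in_diffD)
qed

section \<open>Long minimal representations as copies of one element\<close>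

lemma mset_take_mono:
  assumes "r \<le> r'"
  shows "mset (take r xs) \<subseteq># mset (take r' xs)"
proof -
  have "take r' xs = take r xs @ take (r' - r) (drop r xs)"
    using take_add[of r "r' - r" xs] assms by simp
  then show ?thesis by simp
qed

text \<open>Among all minimal representations of the same value and size take one with an element g of
  largest multiplicity m. If other elements are left, the sums of i copies of g (i at most m) and a
  prefix of the others are too many to be distinct modulo b, and a coincidence allows to trade some
  of the others for further copies of g.\<close>

lemma minimal_rep_constant:
  assumes B: "B \<subseteq> {0<..<b}" and S: "minimal_rep b B S" and large: "b < 2 * int (size S)"
    and "b \<ge> 1"
  obtains g where "g \<in> B" "minimal_rep b B (replicate_mset (size S) g)"
    "int (size S) * g = sum_mset S"
proof -
  define P where "P = (\<lambda>(S', g :: int). minimal_rep b B S' \<and> sum_mset S' = sum_mset S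
    \<and> size S' = size S)"
  have "\<exists>p. P p \<and> (\<forall>q. P q \<longrightarrow> count (fst q) (snd q) \<le> count (fst p) (snd p))"
  proof (rule ex_has_greatest_nat)
    \<comment> \<open>The 0 is arbitrary, as \<open>P\<close> does not constrain the second
      component. The maximum exists because multiplicities are bounded by the size of S.\<close>
    show "P (S, 0)" using S by (simp add: P_def)
    show "\<forall>y. P y \<longrightarrow> count (fst y) (snd y) < Suc (size S)"
    proof (intro allI impI)
      fix y assume "P y"
      then show "count (fst y) (snd y) < Suc (size S)"
        using count_le_size[of "fst y" "snd y"] by (auto simp: P_def less_Suc_eq_le)
    qed
  qed
  then obtain S' g where S': "minimal_rep b B S'" "sum_mset S' = sum_mset S" "size S' = size S"
    and max: "\<And>S'' g'. \<lbrakk>minimal_rep b B S''; sum_mset S'' = sum_mset S; size S'' = size S\<rbrakk>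
      \<Longrightarrow> count S'' g' \<le> count S' g"
    unfolding P_def by fastforce
  define m where "m = count S' g"
  define R where "R = filter_mset (\<lambda>x. x \<noteq> g) S'"
  have decomp: "S' = replicate_mset m g + R"
    unfolding m_def R_def by (rule multiset_eqI) auto
  have "S' \<noteq> {#}" using S'(3) large \<open>b \<ge> 1\<close> by auto
  then obtain x where "x \<in># S'" by blast
  then have m: "m \<ge> 1" using max[OF S', of x] unfolding m_def
    by (metis count_greater_eq_one_iff order_trans)
  then have g: "g \<in> B" using S'(1) unfolding m_def minimal_rep_def
    by (metis count_greater_eq_one_iff subsetD)
  have "R = {#}"
  proof (rule ccontr)
    assume "R \<noteq> {#}"
    obtain xs where xs: "mset xs = R" using ex_mset by blast
    define W where "W r = mset (take r xs)" for r
    define f where "f = (\<lambda>(i, r). (int i * g + sum_mset (W r)) mod b)"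
    have lx: "length xs \<ge> 1" using xs \<open>R \<noteq> {#}\<close> by (cases xs) auto
    have size_eq: "m + length xs = size S"
      using S'(3) xs by (subst (asm) decomp) (auto simp flip: size_mset)
    have W_sub: "W r \<subseteq># R" for r
      unfolding W_def xs[symmetric] using mset_take_mono[of r "max r (length xs)" xs] by simp
    \<comment> \<open>The prefixes \<open>W r\<close> form a chain, so two different ones differ by
      a nonempty part V of R, which does not contain g.\<close>
    have no_coll: False
      if coll: "[int i * g + sum_mset (W r) = int i' * g + sum_mset (W r')] (mod b)"
        and "i \<le> m" "i' \<le> m" "r < r'" "r' \<le> length xs" for i i' r r'
    proof -
      define V where "V = W r' - W r"
      have W: "W r' = W r + V"
        using mset_take_mono[of r r' xs] that unfolding V_def W_def by simp
      have "size (W r) < size (W r')" unfolding W_def using that by simp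
      then have V0: "V \<noteq> {#}" using W by auto
      have VR: "V \<subseteq># R" unfolding V_def using W_sub by (meson diff_subset_eq_self subset_mset.order_trans)
      have VB: "set_mset V \<subseteq> B"
        using set_mset_mono[OF VR] S'(1) unfolding minimal_rep_def R_def by auto
      show False
      proof (cases "i \<le> i'")
        \<comment> \<open>Here V together with \<open>i' - i\<close> copies of g has a sum divisible
          by b.\<close>
        case True
        have sub: "replicate_mset (i' - i) g + V \<subseteq># S'"
          unfolding decomp using VR that
          by (intro subset_mset.add_mono) (auto simp flip: count_le_replicate_mset_subset_eq)
        have "sum_mset (replicate_mset (i' - i) g + V)
            = int i' * g + sum_mset (W r') - (int i * g + sum_mset (W r))"
          unfolding W using True by (simp add: of_nat_diff algebra_simps)
        then have "b dvd sum_mset (replicate_mset (i' - i) g + V)"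
          using cong_sym[OF coll] by (simp only: cong_iff_dvd_diff)
        then show False
          using minimal_rep_zero_sum_free[OF B S'(1) sub] V0 by simp
      next
        case False
        \<comment> \<open>Now U and V are congruent parts of S'. Minimality of each against the
          other makes sums and sizes equal, so trading V for U is allowed and raises the
          multiplicity of g above its maximum.\<close>
        define U where "U = replicate_mset (i - i') g"
        have US: "U \<subseteq># S'"
          unfolding U_def using that(2) by (simp add: m_def flip: count_le_replicate_mset_subset_eq)
        have VS: "V \<subseteq># S'"
          using VR unfolding R_def by (meson multiset_filter_subset subset_mset.order_trans)
        have UB: "set_mset U \<subseteq> B" unfolding U_def using g by auto
        have "sum_mset U - sum_mset V = int i * g + sum_mset (W r) - (int i' * g + sum_mset (W r'))"
          using False unfolding W U_def by (simp add: of_nat_diff algebra_simps)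
        then have UV: "[sum_mset U = sum_mset V] (mod b)"
          using coll by (simp only: cong_iff_dvd_diff)
        note U_min = minimal_repD[OF minimal_rep_subset[OF S'(1) US] VB cong_sym[OF UV]]
        note V_min = minimal_repD[OF minimal_rep_subset[OF S'(1) VS] UB UV]
        have eq: "sum_mset U = sum_mset V" using U_min(1) V_min(1) by simp
        then have eq': "size U = size V" using U_min(2) V_min(2) by simp
        have "count (S' - V + U) g \<le> count S' g"
          using minimal_rep_swap[OF S'(1) VS UB eq eq'] S' by (intro max) auto
        moreover have "count V g = 0"
          using mset_subset_eq_count[OF VR, of g] unfolding R_def by simp
        ultimately show False using False unfolding U_def by simp
      qed
    qed
    have "inj_on f ({0..m} \<times> {0..length xs})"
    proof (rule inj_onI, clarify)
      fix i r i' r' assume ir: "i \<in> {0..m}" "r \<in> {0..length xs}" "i' \<in> {0..m}" "r' \<in> {0..length xs}"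
        "f (i, r) = f (i', r')"
      then have coll: "[int i * g + sum_mset (W r) = int i' * g + sum_mset (W r')] (mod b)"
        by (simp add: f_def cong_def)
      then have r: "r = r'"
        using no_coll[OF coll] no_coll[OF cong_sym[OF coll]] ir by force
      have same: "j = j'" if "[int j * g = int j' * g] (mod b)" "j \<le> j'" "j' \<le> m" for j j'
      proof -
        have "sum_mset (replicate_mset (j' - j) g) = int j' * g - int j * g"
          using that by (simp add: of_nat_diff algebra_simps)
        then have "b dvd sum_mset (replicate_mset (j' - j) g)"
          using cong_sym[OF that(1)] by (simp only: cong_iff_dvd_diff)
        moreover have "replicate_mset (j' - j) g \<subseteq># S'"
          using that by (simp add: m_def flip: count_le_replicate_mset_subset_eq)
        ultimately have "replicate_mset (j' - j) g = {#}"
          using minimal_rep_zero_sum_free[OF B S'(1)] by blast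
        then show ?thesis using that(2) by (simp flip: size_eq_0_iff_empty)
      qed
      have "[int i * g = int i' * g] (mod b)"
        using coll r by (simp add: cong_add_rcancel)
      then show "i = i' \<and> r = r'"
        using same[of i i'] same[of i' i] cong_sym ir r by (metis atLeastAtMost_iff nat_le_linear)
    qed
    moreover have "f ` ({0..m} \<times> {0..length xs}) \<subseteq> {0..<b}"
      using \<open>b \<ge> 1\<close> by (auto simp: f_def)
    ultimately have "card ({0..m} \<times> {0..length xs}) \<le> nat b"
      using card_inj_on_le[of f "{0..m} \<times> {0..length xs}" "{0..<b}"] by simp
    then have "(m + 1) * (length xs + 1) \<le> nat b" by simp
    \<comment> \<open>The difference of the two sides is (m - 1)(l - 1) with l =
      \<open>length xs\<close>, and both factors are nonnegative.\<close>
    moreover have "2 * (m + length xs) \<le> (m + 1) * (length xs + 1)"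
      using m lx by (auto simp: algebra_simps le_iff_add)
    ultimately have "2 * size S \<le> nat b" unfolding size_eq by (rule order_trans[rotated])
    then show False using large \<open>b \<ge> 1\<close> by linarith
  qed
  then have "S' = replicate_mset (size S) g" using decomp S'(3) by simp
  then show thesis using that g S' by (metis sum_mset_replicate_mset)
qed

section \<open>Exchange between two representations of the same number\<close>

text \<open>Elements are collected until the weight reaches t. The last one overshoots by less than
  M. Those before it weigh less than t, and since each weighs at least 1, there are at most t - 1 of
  them.\<close>

lemma submultiset_with_weight:
  fixes w :: "'a \<Rightarrow> int"
  assumes "\<And>x. x \<in># Q \<Longrightarrow> 1 \<le> w x \<and> w x \<le> M" and "0 < t" and "t \<le> (\<Sum>x\<in>#Q. w x)"
  obtains V where "V \<subseteq># Q" "t \<le> (\<Sum>x\<in>#V. w x)" "(\<Sum>x\<in>#V. w x) < t + M" "int (size V) \<le> t"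
proof -
  have size_le: "int (size V) \<le> (\<Sum>x\<in>#V. w x)" if "\<And>x. x \<in># V \<Longrightarrow> 1 \<le> w x" for V
    using that by (induction V) force+
  have "\<exists>V. V \<subseteq># Q \<and> t \<le> (\<Sum>x\<in>#V. w x) \<and> (\<Sum>x\<in>#V. w x) < t + M \<and> int (size V) \<le> t"
    using assms(1,3)
  proof (induction Q)
    case empty
    then show ?case using \<open>0 < t\<close> by simp
  next
    case (add x Q)
    show ?case
    proof (cases "t \<le> (\<Sum>x\<in>#Q. w x)")
      case True
      then obtain V where "V \<subseteq># Q" "t \<le> (\<Sum>x\<in>#V. w x)" "(\<Sum>x\<in>#V. w x) < t + M" "int (size V) \<le> t"
        using add.IH add.prems by auto
      then show ?thesis by (meson multi_psub_of_add_self subset_mset.less_imp_le subset_mset.order_trans)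
    next
      case False
      moreover have "int (size Q) \<le> (\<Sum>x\<in>#Q. w x)" using add.prems by (intro size_le) auto
      moreover have "w x \<le> M" using add.prems by auto
      ultimately show ?thesis using add.prems(2) by (intro exI[of _ "add_mset x Q"]) auto
    qed
  qed
  then show thesis using that by blast
qed

text \<open>If a is congruent to y g with y at most k, minimality of the sum forces a = y g, and then
  minimality of the size forces y = 1. Hence y > k for every a other than g, and w = b - y.\<close>

lemma minimal_replicate_residues:
  assumes B: "B \<subseteq> {0<..<b}" and g: "g \<in> B" and min: "minimal_rep b B (replicate_mset k g)"
    and large: "b < 2 * int k"
  shows "coprime g b"
    and "\<And>a. a \<in> B \<Longrightarrow> a \<noteq> g \<Longrightarrow> \<exists>w. 1 \<le> w \<and> w \<le> b - 1 - int k \<and> [a = - w * g] (mod b)"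
proof -
  have b: "b \<ge> 1" using B g by auto
  have zero_free: "u = 0" if "u \<le> k" "b dvd int u * g" for u
    using minimal_rep_zero_sum_free[OF B min, of "replicate_mset u g"] that
    by (simp flip: count_le_replicate_mset_subset_eq size_eq_0_iff_empty)
  show cop: "coprime g b"
  proof (rule ccontr)
    assume "\<not> coprime g b"
    \<comment> \<open>If e is at least 2, then \<open>b div e\<close> copies of g have a sum
      divisible by b, and b / e is at most b / 2, hence below k.\<close>
    define e where "e = gcd g b"
    have "e \<noteq> 1" "e \<noteq> 0" "e \<ge> 0"
      using \<open>\<not> coprime g b\<close> b by (auto simp: e_def coprime_iff_gcd_eq_1)
    then have "e \<ge> 2" by simp
    have be: "b = e * (b div e)" and ge: "g = e * (g div e)" by (simp_all add: e_def)
    have u: "b div e \<ge> 1" using be b \<open>e \<ge> 2\<close> by (simp add: e_def pos_imp_zdiv_pos_iff zdvd_imp_le int_one_le_iff_zero_less)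
    have "2 * (b div e) \<le> e * (b div e)" using u \<open>e \<ge> 2\<close> by (intro mult_right_mono) auto
    then have "nat (b div e) \<le> k" using be large by linarith
    moreover have "b dvd int (nat (b div e)) * g"
    proof -
      have "int (nat (b div e)) * g = b * (g div e)"
        using u be ge by (metis int_nat_eq mult.assoc mult.commute order_trans zero_le_one)
      then show ?thesis by simp
    qed
    ultimately show False using zero_free u by fastforce
  qed
  fix a assume a: "a \<in> B" "a \<noteq> g"
  obtain v where v: "[g * v = 1] (mod b)" using cong_solve_coprime_int[OF cop] by blast
  \<comment> \<open>As v inverts g modulo b, y is the residue of a / g.\<close>
  define y where "y = (a * v) mod b"
  have "[y * g = a * v * g] (mod b)" unfolding y_def by (simp add: cong_def mod_mult_left_eq)
  moreover have "[a * (g * v) = a * 1] (mod b)" using v by (rule cong_scalar_left)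
  ultimately have y: "[y * g = a] (mod b)" by (metis cong_trans mult.assoc mult.commute mult.right_neutral)
  have y_range: "0 \<le> y" "y < b" using b by (simp_all add: y_def)
  have "\<not> b dvd a" using a(1) B zdvd_not_zless[of a b] by auto
  then have "y \<noteq> 0" using y using \<open>\<not> b dvd a\<close> by (auto simp: cong_iff_dvd_diff)
  have "y > int k"
  proof (rule ccontr)
    assume "\<not> y > int k"
    then have "minimal_rep b B (replicate_mset (nat y) g)"
      using minimal_rep_subset[OF min] by (simp flip: count_le_replicate_mset_subset_eq)
    note y_min = minimal_repD[OF this, of "{#a#}"]
    have "y * g \<le> a" using y_min(1) a y y_range by (simp add: cong_sym_eq)
    moreover have "0 \<le> y * g" using y_range B g by auto
    \<comment> \<open>Both numbers lie in [0, b) and are congruent modulo b.\<close>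
    ultimately have "y * g = a"
      using y a B cong_less_imp_eq_int[of "y * g" b a] by auto
    then have "nat y \<le> 1" using y_min(2) a y_range by auto
    then show False using \<open>y \<noteq> 0\<close> \<open>y * g = a\<close> a y_range by (cases "y = 1") auto
  qed
  moreover have "[a = - (b - y) * g] (mod b)"
  proof -
    have "a - - (b - y) * g = (a - y * g) + b * g" by (simp add: algebra_simps)
    moreover have "b dvd (a - y * g) + b * g" using cong_sym[OF y] by (simp add: cong_iff_dvd_diff)
    ultimately show ?thesis by (simp only: cong_iff_dvd_diff)
  qed
  ultimately show "\<exists>w. 1 \<le> w \<and> w \<le> b - 1 - int k \<and> [a = - w * g] (mod b)"
    using y_range by (intro exI[of _ "b - y"]) auto
qed

text \<open>T arises by reflecting a representation of N b - n, so j may be negative. In the critical case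
  j < 0 and N < size S + i, a small part V of T whose sum is congruent to z g, with z at most k, is
  exchanged for z of the k copies of g.\<close>

lemma interpolate_representations:
  assumes B: "B \<subseteq> {0<..<b}" and S: "minimal_rep b B S" and T: "set_mset T \<subseteq> B"
    and "size T \<le> size S" and "0 \<le> i" and "b \<ge> 1"
    and nS: "n = sum_mset S + i * b" and nT: "n = sum_mset T + j * b"
    and N: "b - 1 \<le> N" and jN: "int (size T) + j \<le> N"
  shows "\<exists>M t. set_mset M \<subseteq> B \<and> 0 \<le> t \<and> n = sum_mset M + t * b \<and> int (size M) + t \<le> N"
proof (rule ccontr)
  assume none: "\<not> ?thesis"
  have contra: "N < int (size M) + t"
    if "set_mset M \<subseteq> B" "0 \<le> t" "n = sum_mset M + t * b" for M t
  proof (rule ccontr)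
    assume "\<not> ?thesis"
    then have "int (size M) + t \<le> N" by simp
    then show False using none that by blast
  qed
  define k where "k = size S"
  have SB: "set_mset S \<subseteq> B" using S by (simp add: minimal_rep_def)
  have i_large: "N < int k + i" using contra[OF SB \<open>0 \<le> i\<close> nS] unfolding k_def .
  have j_neg: "j < 0" using contra[OF T _ nT] jN by (cases "0 \<le> j") auto
  \<comment> \<open>Comparing the two sums bounds i - j by \<open>size T\<close>, hence by k. With N
    < k + i and j < 0 this gives 2k >= N + 2 > b, so S is long enough to be replaced by copies of
    g.\<close>
  have "(i - j) * b = sum_mset T - sum_mset S" using nS nT by (simp add: algebra_simps)
  also have "\<dots> \<le> int (size T) * (b - 1)"
    using sum_mset_pos_bounds(2)[OF subset_trans[OF T B]] sum_mset_pos_bounds(1)[OF subset_trans[OF SB B]]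
    by linarith
  also have "\<dots> \<le> int (size T) * b" by (simp add: mult_left_mono)
  finally have "i - j \<le> int (size T)" using \<open>b \<ge> 1\<close> by simp
  then have large: "b < 2 * int k" using i_large j_neg N \<open>size T \<le> size S\<close> unfolding k_def by linarith
  obtain g where g: "g \<in> B" "minimal_rep b B (replicate_mset k g)" "int k * g = sum_mset S"
    using minimal_rep_constant[OF B S] large \<open>b \<ge> 1\<close> unfolding k_def by metis
  note residues = minimal_replicate_residues[OF B g(1,2) large]
  have "\<forall>a \<in> B - {g}. \<exists>w. 1 \<le> w \<and> w \<le> b - 1 - int k \<and> [a = - w * g] (mod b)"
    using residues(2) by blast
  then obtain w where w: "\<And>a. a \<in> B \<Longrightarrow> a \<noteq> g \<Longrightarrow> 1 \<le> w a \<and> w a \<le> b - 1 - int k"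
    "\<And>a. a \<in> B \<Longrightarrow> a \<noteq> g \<Longrightarrow> [a = - w a * g] (mod b)"
    using bchoice[of "B - {g}" "\<lambda>a w. 1 \<le> w \<and> w \<le> b - 1 - int k \<and> [a = - w * g] (mod b)"] by auto
  have k_less: "int k < b"
  proof (rule ccontr)
    assume "\<not> int k < b"
    then have "nat b \<le> k" by linarith
    then show False
      using minimal_rep_zero_sum_free[OF B g(2), of "replicate_mset (nat b) g"] \<open>b \<ge> 1\<close>
      by (simp flip: count_le_replicate_mset_subset_eq size_eq_0_iff_empty)
  qed
  define Q where "Q = filter_mset (\<lambda>a. a \<noteq> g) T"
  define p where "p = count T g"
  have T_eq: "T = replicate_mset p g + Q" unfolding p_def Q_def by (rule multiset_eqI) auto
  have QB: "a \<in> B \<and> a \<noteq> g" if "a \<in># Q" for a using that T by (auto simp: Q_def)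
  have sum_w: "[sum_mset V = - (\<Sum>a\<in>#V. w a) * g] (mod b)" if "V \<subseteq># Q" for V
  proof -
    have "a \<in> B \<and> a \<noteq> g" if "a \<in># V" for a
      using QB mset_subset_eqD[OF \<open>V \<subseteq># Q\<close> that] .
    then show ?thesis
    proof (induction V)
      case (add a V)
      have "[a + sum_mset V = - w a * g + - (\<Sum>a\<in>#V. w a) * g] (mod b)"
        using add.prems by (intro cong_add[OF w(2) add.IH]) auto
      then show ?case by (simp add: algebra_simps)
    qed simp
  qed
  have p_le: "int p \<le> int k"
    using \<open>size T \<le> size S\<close> count_le_size[of T g] unfolding p_def k_def by linarith
  \<comment> \<open>Otherwise k - p + w(Q), which is divisible by b since g is a unit, lies in [0,
    b) and so vanishes. Then p = k and Q is empty, so the two representations agree and i = j, which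
    contradicts j < 0.\<close>
  have "b - int k \<le> (\<Sum>a\<in>#Q. w a)"
  proof (rule ccontr)
    assume small: "\<not> ?thesis"
    have "0 \<le> (\<Sum>a\<in>#Q. w a)"
    proof -
      have "0 \<le> w a" if "a \<in># Q" for a using w(1)[of a] QB[OF that] by simp
      then show ?thesis by (induction Q) auto
    qed
    have "[sum_mset T = int p * g + - (\<Sum>a\<in>#Q. w a) * g] (mod b)"
      using cong_add[OF cong_refl sum_w[of Q]] by (subst T_eq) simp
    moreover have "[sum_mset T = int k * g] (mod b)"
    proof -
      have "sum_mset T - int k * g = b * (i - j)" using nS nT g(3) by (simp add: algebra_simps)
      then show ?thesis by (simp only: cong_iff_dvd_diff) simp
    qed
    ultimately have "[int p * g + - (\<Sum>a\<in>#Q. w a) * g = int k * g] (mod b)"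
      using cong_sym cong_trans by blast
    then have "[(int p - (\<Sum>a\<in>#Q. w a)) * g = int k * g] (mod b)"
      by (simp add: algebra_simps)
    then have "[int p - (\<Sum>a\<in>#Q. w a) = int k] (mod b)"
      using residues(1) by (simp add: cong_mult_rcancel)
    then have "[int k = int p - (\<Sum>a\<in>#Q. w a)] (mod b)" by (rule cong_sym)
    then have "b dvd int k - (int p - (\<Sum>a\<in>#Q. w a))" by (simp only: cong_iff_dvd_diff)
    moreover have "0 \<le> int k - (int p - (\<Sum>a\<in>#Q. w a))" "int k - (int p - (\<Sum>a\<in>#Q. w a)) < b"
      using small p_le \<open>0 \<le> (\<Sum>a\<in>#Q. w a)\<close> by linarith+
    ultimately have "int k - (int p - (\<Sum>a\<in>#Q. w a)) = 0" using zdvd_not_zless by (metis order_le_less)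
    then have "p = k" using p_le \<open>0 \<le> (\<Sum>a\<in>#Q. w a)\<close> by linarith
    moreover have "size T = p + size Q" by (subst T_eq) simp
    ultimately have "size Q = 0" using \<open>size T \<le> size S\<close> unfolding k_def by linarith
    then have "sum_mset T = sum_mset S" using arg_cong[OF T_eq, of sum_mset] g(3) \<open>p = k\<close> by simp
    then have "i = j" using nS nT \<open>b \<ge> 1\<close> by simp
    then show False using j_neg \<open>0 \<le> i\<close> by simp
  qed
  then obtain V where V: "V \<subseteq># Q" "b - int k \<le> (\<Sum>a\<in>#V. w a)"
    "(\<Sum>a\<in>#V. w a) < (b - int k) + (b - 1 - int k)" "int (size V) \<le> b - int k"
    using submultiset_with_weight[of Q w "b - 1 - int k" "b - int k"] w(1) QB k_less by force
  \<comment> \<open>V has weight between b - k and 2b - 2k - 2, which gives exactly the bounds on z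
    below. At most k copies of g can be given up, and the lower bound on z enters the final
    count.\<close>
  define z where "z = b - (\<Sum>a\<in>#V. w a)"
  have z: "0 \<le> z" "z \<le> int k" "2 * int k - b + 2 \<le> z" using V(2,3) large unfolding z_def by linarith+
  have "V \<noteq> {#}" using V(2) k_less by auto
  have "[sum_mset V = z * g] (mod b)"
  proof -
    have "sum_mset V - z * g = (sum_mset V - - (\<Sum>a\<in>#V. w a) * g) + b * (- g)"
      by (simp add: z_def algebra_simps)
    moreover have "b dvd (sum_mset V - - (\<Sum>a\<in>#V. w a) * g) + b * (- g)"
      using sum_w[OF V(1)] by (intro dvd_add) (simp_all only: cong_iff_dvd_diff dvd_triv_left)
    ultimately show ?thesis by (simp only: cong_iff_dvd_diff)
  qed
  \<comment> \<open>Replacing z copies of g by V changes the coefficient of b from i to i -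
    e.\<close>
  then obtain e where "sum_mset V - z * g = b * e" by (auto simp: cong_iff_dvd_diff)
  then have e: "sum_mset V = z * g + b * e" by simp
  have "V \<subseteq># T" using V(1) multiset_filter_subset subset_mset.order_trans unfolding Q_def by blast
  then obtain X where X: "T = V + X" by (auto simp: mset_subset_eq_exists_conv)
  have VB: "set_mset V \<subseteq> B" and XB: "set_mset X \<subseteq> B" using T X by auto
  have less_size: "x < int (size Y)"
    if "set_mset Y \<subseteq> B" "Y \<noteq> {#}" "b * x \<le> sum_mset Y" for x Y
  proof -
    have "b * x \<le> int (size Y) * (b - 1)"
      using sum_mset_pos_bounds(2)[OF subset_trans[OF that(1) B]] that(3) by linarith
    also have "\<dots> < b * int (size Y)" using that(2) by (simp add: algebra_simps nonempty_has_size)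
    finally show ?thesis using \<open>b \<ge> 1\<close> by simp
  qed
  have "0 \<le> g" using g(1) B by auto
  then have "e < int (size V)" using less_size[OF VB \<open>V \<noteq> {#}\<close>] e z(1) by simp
  \<comment> \<open>In full: e <= b - k - 1 <= N - k < i.\<close>
  then have "e \<le> i" using V(4) N i_large by linarith
  \<comment> \<open>The part X of T left after removing V limits i - j - e: all its elements are
    below b, so its sum is below b times its size.\<close>
  have X_sum: "sum_mset X = (int k - z) * g + b * (i - j - e)"
    using nS nT g(3) e unfolding X by (simp add: algebra_simps)
  have "0 \<le> (int k - z) * g" using z(2) \<open>0 \<le> g\<close> by simp
  then have X_bound: "b * (i - j - e) \<le> sum_mset X" using X_sum by linarith
  have "X \<noteq> {#}"
  proof
    assume "X = {#}"
    then have "b * (i - j - e) \<le> 0" using X_bound by simp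
    then have "i - j - e \<le> 0" using \<open>b \<ge> 1\<close> by (simp add: mult_le_0_iff)
    then show False using \<open>e \<le> i\<close> j_neg by linarith
  qed
  then have "i - j - e < int (size X)"
    using less_size[OF XB] X_bound by blast
  \<comment> \<open>Since j <= -1, i - e is at most \<open>size X - 2\<close>. The total is then at
    most k - z + \<open>size T\<close> - 2 <= 2k - z - 2 <= b - 4.\<close>
  then have "int k - z + int (size V) + (i - e) \<le> N"
    using z(3) N j_neg \<open>size T \<le> size S\<close> unfolding k_def X by simp
  moreover have "n = sum_mset (replicate_mset (nat (int k - z)) g + V) + (i - e) * b"
    using nS g(3) e z(2) by (simp add: algebra_simps)
  moreover have "set_mset (replicate_mset (nat (int k - z)) g + V) \<subseteq> B" using VB g(1) by auto
  ultimately show False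
    using contra[of "replicate_mset (nat (int k - z)) g + V" "i - e"] \<open>e \<le> i\<close> z(2) by simp
qed

section \<open>Sumsets and spans in terms of multisets\<close>

lemma sumset_eq_mset: "sumset N A = {sum_mset M | M. set_mset M \<subseteq> A \<and> size M = N}"
proof (intro equalityI subsetI)
  fix x assume "x \<in> sumset N A"
  then obtain f where "x = (\<Sum>i<N. f i)" "\<forall>i<N. f i \<in> A" by (auto simp: sumset_def)
  then show "x \<in> {sum_mset M | M. set_mset M \<subseteq> A \<and> size M = N}"
    by (intro CollectI exI[of _ "image_mset f (mset_set {..<N})"]) (auto simp: sum_unfold_sum_mset)
next
  fix x assume "x \<in> {sum_mset M | M. set_mset M \<subseteq> A \<and> size M = N}"
  then obtain M where M: "x = sum_mset M" "set_mset M \<subseteq> A" "size M = N" by blast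
  obtain xs where "mset xs = M" using ex_mset by blast
  then have xs: "x = sum_list xs" "set xs \<subseteq> A" "length xs = N"
    using M by (auto simp: sum_mset_sum_list)
  then have "x = (\<Sum>i<N. xs ! i)" by (simp add: sum_list_sum_nth atLeast0LessThan)
  then show "x \<in> sumset N A" using xs unfolding sumset_def by (auto intro!: exI[of _ "(!) xs"])
qed

lemma nat_span_eq_mset:
  assumes "finite A"
  shows "nat_span A = {sum_mset M | M. set_mset M \<subseteq> A}"
proof (intro equalityI subsetI)
  fix x assume "x \<in> nat_span A"
  then obtain c :: "int \<Rightarrow> nat" where "x = (\<Sum>a\<in>A. int (c a) * a)" by (auto simp: nat_span_def)
  also have "(\<Sum>a\<in>A. int (c a) * a) = sum_mset (\<Sum>a\<in>A. replicate_mset (c a) a)"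
    by (induction A rule: infinite_finite_induct) auto
  finally have "x = sum_mset (\<Sum>a\<in>A. replicate_mset (c a) a)" .
  moreover have "set_mset (\<Sum>a\<in>A. replicate_mset (c a) a) \<subseteq> A"
    using assms by induction (auto split: if_splits)
  ultimately show "x \<in> {sum_mset M | M. set_mset M \<subseteq> A}" by blast
next
  fix x assume "x \<in> {sum_mset M | M. set_mset M \<subseteq> A}"
  then obtain M where M: "x = sum_mset M" "set_mset M \<subseteq> A" by blast
  have "sum_mset M = (\<Sum>a\<in>A. int (count M a) * a)"
    using M(2)
  proof (induction M)
    case (add x M)
    have "int (count (add_mset x M) a) * a = (if a = x then x else 0) + int (count M a) * a" for a
      by (simp add: algebra_simps)
    then show ?case using add assms by (simp add: sum.distrib)
  qed simp
  then show "x \<in> nat_span A" using M(1) by (auto simp: nat_span_def)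
qed

lemma sum_mset_reflect:
  fixes M :: "int multiset"
  shows "sum_mset (image_mset (\<lambda>x. b - x) M) = int (size M) * b - sum_mset M"
  by (induction M) (auto simp: algebra_simps)

text \<open>Zeros are dropped and copies of b are counted by i. Making the remainder minimal can
  only lower its sum by a multiple of b, which is added to i.\<close>

lemma minimal_rep_of_span:
  assumes A: "A \<subseteq> {0..b}" and M: "set_mset M \<subseteq> A" and "b \<ge> 1"
  obtains S i where "minimal_rep b (A - {0, b}) S" "0 \<le> i" "sum_mset M = sum_mset S + i * b"
proof -
  have "\<exists>S i. set_mset S \<subseteq> A - {0, b} \<and> 0 \<le> i \<and> sum_mset M = sum_mset S + i * b"
    using M
  proof (induction M)
    case empty
    show ?case by (intro exI[of _ "{#}"] exI[of _ 0]) simp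
  next
    case (add x M)
    then obtain S i where S: "set_mset S \<subseteq> A - {0, b}" "0 \<le> i" "sum_mset M = sum_mset S + i * b"
      by auto
    consider "x = 0" | "x = b" | "x \<in> A - {0, b}" using add.prems by auto
    then show ?case
    proof cases
      case 1
      then show ?thesis using S by auto
    next
      case 2
      then show ?thesis using S by (intro exI[of _ S] exI[of _ "i + 1"]) (simp add: algebra_simps)
    next
      case 3
      then show ?thesis using S by (intro exI[of _ "add_mset x S"] exI[of _ i]) simp
    qed
  qed
  then obtain S0 i0 where S0: "set_mset S0 \<subseteq> A - {0, b}" "0 \<le> i0"
    "sum_mset M = sum_mset S0 + i0 * b" by blast
  have "A - {0, b} \<subseteq> {0<..<b}" using A by force
  then obtain S where S: "minimal_rep b (A - {0, b}) S" "[sum_mset S = sum_mset S0] (mod b)"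
    "sum_mset S \<le> sum_mset S0"
    using minimal_rep_exists S0(1) by blast
  have "b dvd sum_mset S0 - sum_mset S" using cong_sym[OF S(2)] by (simp only: cong_iff_dvd_diff)
  then obtain q where q: "sum_mset S0 - sum_mset S = b * q" by (rule dvdE)
  then have "0 \<le> b * q" using S(3) by linarith
  then have "0 \<le> q" using \<open>b \<ge> 1\<close> by (simp add: zero_le_mult_iff)
  then have "sum_mset M = sum_mset S + (i0 + q) * b" "0 \<le> i0 + q"
    using q S0 by (simp_all add: algebra_simps)
  then show thesis using that S(1) by blast
qed

section \<open>Combining the representations over A and b - A\<close>

lemma mem_reflect_iff: "x \<in> reflect m X \<longleftrightarrow> m - x \<in> X"
  by (force simp: reflect_def)

lemma mem_sumset_of_spans:
  assumes A: "A \<subseteq> {0..b}" "0 \<in> A" "b \<in> A" and "b \<ge> 1" and N: "b - 1 \<le> int N"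
    and M1: "set_mset M1 \<subseteq> A" "n = sum_mset M1"
    and M2: "set_mset M2 \<subseteq> reflect b A" "int N * b - n = sum_mset M2"
  shows "n \<in> sumset N A"
proof -
  let ?refl = "image_mset (\<lambda>x. b - x)"
  obtain S i where S: "minimal_rep b (A - {0, b}) S" "0 \<le> i" "n = sum_mset S + i * b"
    using minimal_rep_of_span[OF A(1) M1(1) \<open>b \<ge> 1\<close>] M1(2) by metis
  have "reflect b A \<subseteq> {0..b}" using A(1) by (force simp: reflect_def)
  then obtain T j where T: "minimal_rep b (reflect b A - {0, b}) T" "0 \<le> j"
    "int N * b - n = sum_mset T + j * b"
    using minimal_rep_of_span[OF _ M2(1) \<open>b \<ge> 1\<close>] M2(2) by metis
  have B: "A - {0, b} \<subseteq> {0<..<b}" "reflect b A - {0, b} \<subseteq> {0<..<b}"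
    using A(1) by (force simp: reflect_def)+
  have refl_B: "set_mset (?refl X) \<subseteq> A - {0, b}" if "set_mset X \<subseteq> reflect b A - {0, b}" for X
    using that by (fastforce simp: mem_reflect_iff)
  have refl_B': "set_mset (?refl X) \<subseteq> reflect b A - {0, b}" if "set_mset X \<subseteq> A - {0, b}" for X
    using that by (fastforce simp: mem_reflect_iff)
  have "\<exists>M t. set_mset M \<subseteq> A - {0, b} \<and> 0 \<le> t \<and> n = sum_mset M + t * b \<and> int (size M) + t \<le> int N"
  proof (cases "size T \<le> size S")
    case True
    show ?thesis
    proof (rule interpolate_representations[OF B(1) S(1)])
      show "set_mset (?refl T) \<subseteq> A - {0, b}" using T(1) by (intro refl_B) (simp add: minimal_rep_def)
      \<comment> \<open>The new coefficient of b may be negative, but added to \<open>size T\<close>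
        it gives N - j, which is at most N.\<close>
      show "n = sum_mset (?refl T) + (int N - int (size T) - j) * b"
        using T(3) by (simp add: sum_mset_reflect algebra_simps)
    qed (use True S T N \<open>b \<ge> 1\<close> in simp_all)
  next
    case False
    have "\<exists>M t. set_mset M \<subseteq> reflect b A - {0, b} \<and> 0 \<le> t \<and>
        int N * b - n = sum_mset M + t * b \<and> int (size M) + t \<le> int N"
    proof (rule interpolate_representations[OF B(2) T(1)])
      show "set_mset (?refl S) \<subseteq> reflect b A - {0, b}" using S(1) by (intro refl_B') (simp add: minimal_rep_def)
      show "int N * b - n = sum_mset (?refl S) + (int N - int (size S) - i) * b"
        using S(3) by (simp add: sum_mset_reflect algebra_simps)
    qed (use False S T N \<open>b \<ge> 1\<close> in simp_all)
    then obtain M t where M: "set_mset M \<subseteq> reflect b A - {0, b}" "0 \<le> t"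
      "int N * b - n = sum_mset M + t * b" "int (size M) + t \<le> int N" by blast
    show ?thesis
    \<comment> \<open>Reflecting back, the bound on \<open>size M + t\<close> makes the new
      coefficient nonnegative, and t >= 0 makes the new number of summands, N - t, at most
      N.\<close>
    proof (intro exI conjI)
      show "set_mset (?refl M) \<subseteq> A - {0, b}" using refl_B M(1) .
      show "n = sum_mset (?refl M) + (int N - int (size M) - t) * b"
        using M(3) by (simp add: sum_mset_reflect algebra_simps)
    qed (use M in simp_all)
  qed
  then obtain M t where M: "set_mset M \<subseteq> A - {0, b}" "0 \<le> t" "n = sum_mset M + t * b"
    "int (size M) + t \<le> int N" by blast
  \<comment> \<open>The multiple of b becomes t summands b, and zeros pad the number of summands to
    exactly N.\<close>
  define X where "X = M + replicate_mset (nat t) b + replicate_mset (N - size M - nat t) 0"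
  have "set_mset X \<subseteq> A" "size X = N" "sum_mset X = n"
    using M A by (auto simp: X_def split: if_splits)
  then show ?thesis unfolding sumset_eq_mset by blast
qed

theorem theorem1:
  fixes A :: "int set" and b :: int and N :: nat
  assumes "finite A" and "A \<noteq> {}"
    and "Min A = 0" and "Max A = b" and "b \<ge> 1"
    and "Gcd A = 1"
    and "N \<ge> 1" and "int N \<ge> 2 * \<lfloor>real_of_int b / 2\<rfloor>"
  shows "(\<forall>n. 0 \<le> n \<and> n \<le> int N * b \<and>
            n \<notin> exceptional A \<union> reflect (int N * b) (exceptional (reflect b A)) \<longrightarrow>
            n \<in> sumset N A) \<and>
         sumset N A =
           {0..int N * b} - (exceptional A \<union> reflect (int N * b) (exceptional (reflect b A)))"
proof -
  have A: "0 \<in> A" "b \<in> A" using assms(1-4) Min_in[of A] Max_in[of A] by auto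
  have Ab: "A \<subseteq> {0..b}" using assms(1,3,4) Min_le[of A] Max_ge[of A] by auto
  \<comment> \<open>For odd b, 2 floor(b/2) is only b - 1, so this is the bound available for both
    parities.\<close>
  have N: "b - 1 \<le> int N" using assms(8) by linarith
  have fin: "finite (reflect b A)" using assms(1) by (simp add: reflect_def)
  have exc: "n \<in> exceptional A \<union> reflect (int N * b) (exceptional (reflect b A)) \<longleftrightarrow>
      n \<notin> nat_span A \<or> int N * b - n \<notin> nat_span (reflect b A)"
    if "0 \<le> n" "n \<le> int N * b" for n
    using that by (auto simp: mem_reflect_iff exceptional_def)
  have sub: "n \<in> sumset N A" if "n \<in> nat_span A" "int N * b - n \<in> nat_span (reflect b A)" for n
    using mem_sumset_of_spans[OF Ab A assms(5) N] that
    unfolding nat_span_eq_mset[OF assms(1)] nat_span_eq_mset[OF fin] by blast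
  \<comment> \<open>The easy inclusion: replacing each of the N summands a by b - a represents N b -
    n over b - A.\<close>
  have sup: "0 \<le> n \<and> n \<le> int N * b \<and> n \<in> nat_span A \<and> int N * b - n \<in> nat_span (reflect b A)"
    if n: "n \<in> sumset N A" for n
  proof -
    obtain M where M: "set_mset M \<subseteq> A" "size M = N" "n = sum_mset M"
      using n unfolding sumset_eq_mset by blast
    have "set_mset M \<subseteq> {0..b}" using M(1) Ab by blast
    then have "0 \<le> sum_mset M \<and> sum_mset M \<le> int (size M) * b"
      by (induction M) (auto simp: algebra_simps)
    moreover have "set_mset (image_mset (\<lambda>x. b - x) M) \<subseteq> reflect b A"
      using M(1) by (auto simp: reflect_def)
    moreover have "int N * b - n = sum_mset (image_mset (\<lambda>x. b - x) M)"
      using M by (simp add: sum_mset_reflect)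
    ultimately show ?thesis
      unfolding nat_span_eq_mset[OF assms(1)] nat_span_eq_mset[OF fin] using M by blast
  qed
  show ?thesis
  proof (intro conjI allI impI)
    show "n \<in> sumset N A" if "0 \<le> n \<and> n \<le> int N * b \<and>
        n \<notin> exceptional A \<union> reflect (int N * b) (exceptional (reflect b A))" for n
      using that exc[of n] sub[of n] by blast
    show "sumset N A =
        {0..int N * b} - (exceptional A \<union> reflect (int N * b) (exceptional (reflect b A)))"
    proof (intro equalityI subsetI)
      fix n assume "n \<in> sumset N A"
      then show "n \<in> {0..int N * b} - (exceptional A \<union> reflect (int N * b) (exceptional (reflect b A)))"
        using sup[of n] exc[of n] by simp
    next
      fix n assume "n \<in> {0..int N * b} - (exceptional A \<union> reflect (int N * b) (exceptional (reflect b A)))"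
      then show "n \<in> sumset N A" using sub[of n] exc[of n] by simp
    qed
  qed
qed

end
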